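(* Let $A,B\in\mathbb{R}_{+}^{n\times n}$, where $A$ has nonzero spectral radius and $\mathrm{Tr}(B)\leq 1$ (all matrix operations are in max-algebra). Consider the problem of minimizing $x^{-}Ax$ over all regular vectors $x\in\mathbb{R}_{+}^{n}$ subject to $Bx\leq x$, and let $\theta$ be the minimum value of the objective function in this problem, given by $$\theta=\bigoplus_{k=1}^{n}\ \bigoplus_{0\leq i_{1}+\cdots+i_{k}\leq n-k}\mathrm{tr}^{1/k}(AB^{i_{1}}\cdots AB^{i_{k}}),$$ where $i_1,\ldots,i_k$ range over nonnegative integers. Then, for a vector $x$, the following assertions are equivalent: (i) $x$ is a regular solution of the problem (that is, $x$ is regular, $Bx\leq x$, and $x^{-}Ax=\theta$). (ii) $x$ is a regular solution of the inequality $(\theta^{-1}A\oplus B)x\leq x$. (iii) $x$ is a regular vector given in the parametric form $x=(\theta^{-1}A\oplus B)^{\ast}u$, where $u\in\mathbb{R}_{+}^{n}$, $u\neq 0$, is a vector of parameters.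
   Context: Max-algebra: the set $\mathbb{R}_{+}$ of nonnegative reals with addition $a\oplus b=\max(a,b)$ and the usual multiplication. Matrices and vectors over $\mathbb{R}_+$ are added and multiplied by the usual rules with $+$ replaced by $\oplus$; scalar multiplication is usual; inequalities are entrywise; $I$ is the usual identity matrix; $A^{0}=I$, $A^{p}=AA^{p-1}$ for integers $p\geq 1$. A vector is regular if it has no zero entries (i.e. it is positive). For a nonzero column vector $x=(x_j)$, $x^{-}$ is the row vector with entries $x_j^{-1}$ if $x_j\neq 0$ and $0$ otherwise; so for regular $x$, $x^{-}Ax=\max_{i,j}x_i^{-1}a_{ij}x_j$. For $A=(a_{ij})\in\mathbb{R}_+^{n\times n}$: $\mathrm{tr}A=\bigoplus_{k=1}^{n}a_{kk}$; $\mathrm{tr}^{1/k}(A)=(\mathrm{tr}A)^{1/k}$; $\mathrm{Tr}(A)=\bigoplus_{k=1}^{n}\mathrm{tr}A^{k}$; the spectral radius of $A$ is $\bigoplus_{k=1}^{n}\mathrm{tr}^{1/k}(A^{k})$. If $\mathrm{Tr}(A)\leq 1$, the Kleene star is $A^{\ast}=\bigoplus_{k=0}^{n-1}A^{k}$. *)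

theory Defs
  imports "HOL-Analysis.Analysis"
begin

text \<open>
  Max-algebra on square matrices and vectors. Entries are of type real; nonnegativity is
  imposed as a hypothesis (\<open>0 \<le> A\<close>, entrywise by the library order on vectors), and
  all operations below preserve it. Index types are finite and nonempty, so every \<open>MAX\<close>
  over all indices is a genuine maximum.
\<close>

definition madd :: "real^'n^'n \<Rightarrow> real^'n^'n \<Rightarrow> real^'n^'n"  (infixl "\<oplus>" 65) where
  "A \<oplus> B = (\<chi> i j. max (A $ i $ j) (B $ i $ j))"

definition mmult :: "real^'n^'n \<Rightarrow> real^'n^'n \<Rightarrow> real^'n^'n"  (infixl "\<otimes>" 70) where
  "A \<otimes> B = (\<chi> i j. MAX k. A $ i $ k * B $ k $ j)"

definition mvmult :: "real^'n^'n \<Rightarrow> real^'n \<Rightarrow> real^'n"  (infixr "\<otimes>v" 70) where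
  "A \<otimes>v x = (\<chi> i. MAX j. A $ i $ j * x $ j)"

definition rcmult :: "real^'n \<Rightarrow> real^'n \<Rightarrow> real"  (infix "\<otimes>r" 69) where
  "y \<otimes>r x = (MAX i. y $ i * x $ i)"

primrec mpow :: "real^'n^'n \<Rightarrow> nat \<Rightarrow> real^'n^'n" where
  "mpow A 0 = mat 1"
| "mpow A (Suc p) = A \<otimes> mpow A p"

definition mtr :: "real^'n^'n \<Rightarrow> real" where
  "mtr A = (MAX k. A $ k $ k)"

definition mTr :: "real^'n^'n \<Rightarrow> real" where
  "mTr A = (MAX k\<in>{1..CARD('n)}. mtr (mpow A k))"

definition mspectral_radius :: "real^'n^'n \<Rightarrow> real" where
  "mspectral_radius A = (MAX k\<in>{1..CARD('n)}. root k (mtr (mpow A k)))"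

text \<open>Total for convenience; it is the Kleene star of \<open>A\<close> only when \<open>mTr A \<le> 1\<close>.\<close>

definition mstar :: "real^'n^'n \<Rightarrow> real^'n^'n" where
  "mstar A = (\<chi> i j. MAX k\<in>{0..CARD('n) - 1}. mpow A k $ i $ j)"

definition regular :: "real^'n \<Rightarrow> bool" where
  "regular x \<longleftrightarrow> 0 \<le> x \<and> (\<forall>i. x $ i \<noteq> 0)"

text \<open>The row vector \<open>x\<^sup>-\<close>; thus \<open>mconj x \<otimes>r (A \<otimes>v x)\<close> is \<open>x\<^sup>- A x\<close>.\<close>

definition mconj :: "real^'n \<Rightarrow> real^'n" where
  "mconj x = (\<chi> i. if x $ i \<noteq> 0 then inverse (x $ i) else 0)"

text \<open>
  \<open>mword A B [i\<^sub>1, \<dots>, i\<^sub>k]\<close> is the product \<open>A B\<^bsup>i\<^sub>1\<^esup> \<cdots> A B\<^bsup>i\<^sub>k\<^esup>\<close>.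
\<close>

primrec mword :: "real^'n^'n \<Rightarrow> real^'n^'n \<Rightarrow> nat list \<Rightarrow> real^'n^'n" where
  "mword A B [] = mat 1"
| "mword A B (i # is) = (A \<otimes> mpow B i) \<otimes> mword A B is"

end

theory Submission
  imports Defs
begin

text \<open>
  Put \<open>C = \<theta>\<^sup>-\<^sup>1 A \<oplus> B\<close>. A regular \<open>x\<close> with \<open>B x \<le> x\<close> and \<open>A x \<le> \<mu> x\<close> satisfies
  \<open>A B\<^bsup>i\<^sub>1\<^esup> \<cdots> A B\<^bsup>i\<^sub>k\<^esup> x \<le> \<mu>\<^sup>k x\<close>; the diagonal entries give \<open>\<theta> \<le> \<mu>\<close>, hence (i) and (ii)
  are equivalent. Conversely, the trace is invariant under cyclic shifts, so every closed walk of
  length at most \<open>n\<close> in the digraph of \<open>C\<close> is dominated by a diagonal entry of a power of \<open>B\<close> or of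
  a word \<open>A B\<^bsup>i\<^sub>1\<^esup> \<cdots> A B\<^bsup>i\<^sub>k\<^esup>\<close> scaled by \<open>\<theta>\<^bsup>-k\<^esup>\<close>. Thus \<open>Tr C \<le> 1\<close>, so cutting out cycles
  gives \<open>C C\<^sup>* \<le> C\<^sup>*\<close>, which yields (iii) and, applied to the vector of ones, attainment of \<open>\<theta>\<close>.
\<close>

section \<open>Matrix algebra over the max-times semiring\<close>

lemma MAX_UNIV_ge: "f k \<le> (MAX k. f k)" for f :: "'n::finite \<Rightarrow> real"
  by (rule Max_ge) auto

lemma MAX_UNIV_le_iff: "(MAX k. f k) \<le> c \<longleftrightarrow> (\<forall>k. f k \<le> c)" for f :: "'n::finite \<Rightarrow> real"
  by (subst Max_le_iff) auto

lemma MAX_UNIV_attained: "\<exists>k. (MAX k. f k) = f k" for f :: "'n::finite \<Rightarrow> real"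
proof -
  have "(MAX k. f k) \<in> range f" by (rule Max_in) auto
  then obtain k where "(MAX k. f k) = f k" by (rule imageE)
  then show ?thesis by (rule exI)
qed

lemma matrix_nonneg_iff: "0 \<le> X \<longleftrightarrow> (\<forall>i j. 0 \<le> X $ i $ j)" for X :: "real^'n^'m"
  by (simp add: less_eq_vec_def)

lemma mmult_ge: "X $ i $ k * Y $ k $ j \<le> (X \<otimes> Y) $ i $ j"
  unfolding mmult_def by (simp add: MAX_UNIV_ge[where f = "\<lambda>k. X $ i $ k * Y $ k $ j"])

lemma mmult_le_iff: "(X \<otimes> Y) $ i $ j \<le> c \<longleftrightarrow> (\<forall>k. X $ i $ k * Y $ k $ j \<le> c)"
  unfolding mmult_def by (simp add: MAX_UNIV_le_iff)

lemma mmult_attained: "\<exists>k. (X \<otimes> Y) $ i $ j = X $ i $ k * Y $ k $ j"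
  unfolding mmult_def by (simp add: MAX_UNIV_attained)

lemma mmult_nonneg: "0 \<le> X \<Longrightarrow> 0 \<le> Y \<Longrightarrow> 0 \<le> X \<otimes> Y"
  unfolding matrix_nonneg_iff by (meson mmult_ge mult_nonneg_nonneg order_trans)

lemma mat_1_nonneg: "0 \<le> (mat 1 :: real^'n^'n)"
  unfolding matrix_nonneg_iff by (simp add: mat_def)

lemma mmult_mat_1_left:
  assumes "0 \<le> X"
  shows "mat 1 \<otimes> X = X"
proof -
  have "(mat 1 \<otimes> X) $ i $ j = X $ i $ j" for i j
  proof (rule antisym)
    show "(mat 1 \<otimes> X) $ i $ j \<le> X $ i $ j"
      using assms by (auto simp: mmult_le_iff mat_def matrix_nonneg_iff)
    show "X $ i $ j \<le> (mat 1 \<otimes> X) $ i $ j"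
      using mmult_ge[of "mat 1" i i X j] by (simp add: mat_def)
  qed
  then show ?thesis by (simp add: vec_eq_iff)
qed

lemma mmult_mat_1_right:
  assumes "0 \<le> X"
  shows "X \<otimes> mat 1 = X"
proof -
  have "(X \<otimes> mat 1) $ i $ j = X $ i $ j" for i j
  proof (rule antisym)
    show "(X \<otimes> mat 1) $ i $ j \<le> X $ i $ j"
      using assms by (auto simp: mmult_le_iff mat_def matrix_nonneg_iff)
    show "X $ i $ j \<le> (X \<otimes> mat 1) $ i $ j"
      using mmult_ge[of X i j "mat 1" j] by (simp add: mat_def)
  qed
  then show ?thesis by (simp add: vec_eq_iff)
qed

text \<open>Each inner maximum is attained at some index, and the outer factor multiplying it, an
  entry of \<open>X\<close> or \<open>Z\<close>, is nonnegative, so multiplication by it is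
  monotone.\<close>

lemma mmult_assoc:
  assumes "0 \<le> X" "0 \<le> Z"
  shows "(X \<otimes> Y) \<otimes> Z = X \<otimes> (Y \<otimes> Z)"
proof -
  have X: "0 \<le> X $ i $ j" and Z: "0 \<le> Z $ i $ j" for i j
    using assms by (auto simp: matrix_nonneg_iff)
  have "((X \<otimes> Y) \<otimes> Z) $ i $ j = (X \<otimes> (Y \<otimes> Z)) $ i $ j" for i j
  proof (rule antisym)
    have "(X \<otimes> Y) $ i $ k * Z $ k $ j \<le> (X \<otimes> (Y \<otimes> Z)) $ i $ j" for k
    proof -
      obtain l where "(X \<otimes> Y) $ i $ k = X $ i $ l * Y $ l $ k"
        using mmult_attained by blast
      then have "(X \<otimes> Y) $ i $ k * Z $ k $ j = X $ i $ l * (Y $ l $ k * Z $ k $ j)" by simp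
      also have "\<dots> \<le> X $ i $ l * (Y \<otimes> Z) $ l $ j"
        by (intro mult_left_mono mmult_ge X)
      also have "\<dots> \<le> (X \<otimes> (Y \<otimes> Z)) $ i $ j" by (rule mmult_ge)
      finally show ?thesis .
    qed
    then show "((X \<otimes> Y) \<otimes> Z) $ i $ j \<le> (X \<otimes> (Y \<otimes> Z)) $ i $ j" by (simp add: mmult_le_iff)
    have "X $ i $ l * (Y \<otimes> Z) $ l $ j \<le> ((X \<otimes> Y) \<otimes> Z) $ i $ j" for l
    proof -
      obtain k where "(Y \<otimes> Z) $ l $ j = Y $ l $ k * Z $ k $ j"
        using mmult_attained by blast
      then have "X $ i $ l * (Y \<otimes> Z) $ l $ j = (X $ i $ l * Y $ l $ k) * Z $ k $ j" by simp
      also have "\<dots> \<le> (X \<otimes> Y) $ i $ k * Z $ k $ j"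
        by (intro mult_right_mono mmult_ge Z)
      also have "\<dots> \<le> ((X \<otimes> Y) \<otimes> Z) $ i $ j" by (rule mmult_ge)
      finally show ?thesis .
    qed
    then show "(X \<otimes> (Y \<otimes> Z)) $ i $ j \<le> ((X \<otimes> Y) \<otimes> Z) $ i $ j" by (simp add: mmult_le_iff)
  qed
  then show ?thesis by (simp add: vec_eq_iff)
qed

lemma mmult_scaleR_left:
  assumes "0 \<le> c"
  shows "(c *\<^sub>R X) \<otimes> Y = c *\<^sub>R (X \<otimes> Y)"
proof -
  have "((c *\<^sub>R X) \<otimes> Y) $ i $ j = c * (X \<otimes> Y) $ i $ j" for i j
  proof (rule antisym)
    show "((c *\<^sub>R X) \<otimes> Y) $ i $ j \<le> c * (X \<otimes> Y) $ i $ j"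
      using mmult_ge[of X i _ Y j] assms
      by (auto simp: mmult_le_iff mult.assoc intro!: mult_left_mono)
    obtain k where "(X \<otimes> Y) $ i $ j = X $ i $ k * Y $ k $ j"
      using mmult_attained by blast
    then show "c * (X \<otimes> Y) $ i $ j \<le> ((c *\<^sub>R X) \<otimes> Y) $ i $ j"
      using mmult_ge[of "c *\<^sub>R X" i k Y j] by (simp add: mult.assoc)
  qed
  then show ?thesis by (simp add: vec_eq_iff)
qed

lemma mmult_scaleR_right:
  assumes "0 \<le> c"
  shows "X \<otimes> (c *\<^sub>R Y) = c *\<^sub>R (X \<otimes> Y)"
proof -
  have "X \<otimes> (c *\<^sub>R Y) = (c *\<^sub>R X) \<otimes> Y" by (simp add: mmult_def vec_eq_iff ac_simps)
  then show ?thesis using assms by (simp add: mmult_scaleR_left)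
qed

lemma mpow_nonneg: "0 \<le> X \<Longrightarrow> 0 \<le> mpow X k"
  by (induction k) (auto simp: mat_1_nonneg mmult_nonneg)

lemma mpow_add:
  assumes "0 \<le> X"
  shows "mpow X (p + q) = mpow X p \<otimes> mpow X q"
  using assms by (induction p) (auto simp: mmult_mat_1_left mpow_nonneg mmult_assoc)

section \<open>Traces\<close>

lemma mtr_ge: "X $ i $ i \<le> mtr X"
  unfolding mtr_def by (rule MAX_UNIV_ge)

lemma mtr_le_iff: "mtr X \<le> c \<longleftrightarrow> (\<forall>i. X $ i $ i \<le> c)"
  unfolding mtr_def by (rule MAX_UNIV_le_iff)

lemma mtr_nonneg: "0 \<le> X \<Longrightarrow> 0 \<le> mtr X"
  using mtr_ge[of X undefined] by (auto simp: matrix_nonneg_iff intro: order_trans)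

text \<open>The term of the left trace at diagonal position \<open>i\<close> and inner index
  \<open>k\<close> is a term of the right trace at position \<open>k\<close> and inner index
  \<open>i\<close>.\<close>

lemma mtr_mmult_le: "mtr (X \<otimes> Y) \<le> mtr (Y \<otimes> X)"
  unfolding mtr_le_iff[of "X \<otimes> Y"] mmult_le_iff
  by (metis mmult_ge mtr_ge mult.commute order_trans)

lemma mtr_mmult_commute: "mtr (X \<otimes> Y) = mtr (Y \<otimes> X)"
  by (intro antisym mtr_mmult_le)

lemma mpow_le_1_if_mTr_le_1:
  fixes X :: "real^'n^'n"
  assumes "mTr X \<le> 1" "k \<in> {1..CARD('n)}"
  shows "mpow X k $ i $ i \<le> 1"
proof -
  have "mtr (mpow X k) \<le> mTr X"
    unfolding mTr_def using assms(2) by (intro Max_ge) auto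
  then show ?thesis using assms(1) mtr_ge[of "mpow X k" i] by linarith
qed

section \<open>Words in \<open>A\<close> and \<open>B\<close>\<close>

lemma mword_nonneg: "0 \<le> A \<Longrightarrow> 0 \<le> B \<Longrightarrow> 0 \<le> mword A B is"
  by (induction "is") (auto simp: mat_1_nonneg mmult_nonneg mpow_nonneg)

lemma mword_append:
  assumes "0 \<le> A" "0 \<le> B"
  shows "mword A B (is @ js) = mword A B is \<otimes> mword A B js"
  using assms
  by (induction "is") (auto simp: mmult_mat_1_left mword_nonneg mmult_assoc mmult_nonneg mpow_nonneg)

lemma mword_scaleR:
  assumes "0 \<le> c"
  shows "mword (c *\<^sub>R A) B is = c ^ length is *\<^sub>R mword A B is"
  using assms by (induction "is") (auto simp: mmult_scaleR_left mmult_scaleR_right)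

text \<open>Places the traces of the powers of \<open>A\<close> among the terms of \<theta>, which
  later makes \<theta> positive.\<close>

lemma mword_replicate_0:
  assumes "0 \<le> A"
  shows "mword A B (replicate k 0) = mpow A k"
  using assms by (induction k) (auto simp: mmult_mat_1_right)

lemma madd_nonneg: "0 \<le> A \<Longrightarrow> 0 \<le> A \<oplus> B"
  unfolding matrix_nonneg_iff madd_def by (simp add: le_max_iff_disj)

text \<open>Along a maximizing walk every factor comes from \<open>A\<close> or from
  \<open>B\<close>. Here \<open>q\<close> counts the leading letters \<open>B\<close>: a further
  \<open>B\<close> in front raises \<open>q\<close>, while an \<open>A\<close> in front turns
  \<open>q\<close> into the first exponent of the list and resets it to 0. The sum condition counts
  letters.\<close>

lemma mpow_madd_le_mword:
  assumes "0 \<le> A" "0 \<le> B"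
  shows "\<exists>q is. q + length is + sum_list is = m \<and>
           mpow (A \<oplus> B) m $ i $ j \<le> (mpow B q \<otimes> mword A B is) $ i $ j"
proof (induction m arbitrary: i)
  case 0
  then show ?case
    by (intro exI[of _ 0] exI[of _ "[]"]) (simp add: mmult_mat_1_left mat_1_nonneg)
next
  case (Suc m)
  obtain k where k: "mpow (A \<oplus> B) (Suc m) $ i $ j = (A \<oplus> B) $ i $ k * mpow (A \<oplus> B) m $ k $ j"
    using mmult_attained[of "A \<oplus> B" "mpow (A \<oplus> B) m" i j] by auto
  obtain q "is" where qi: "q + length is + sum_list is = m"
    and le: "mpow (A \<oplus> B) m $ k $ j \<le> (mpow B q \<otimes> mword A B is) $ k $ j"
    using Suc.IH by blast
  have nn: "0 \<le> mpow B q" "0 \<le> mword A B is" "0 \<le> mpow B q \<otimes> mword A B is"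
    using assms by (simp_all add: mpow_nonneg mword_nonneg mmult_nonneg)
  have step: "X $ i $ k * mpow (A \<oplus> B) m $ k $ j \<le> (X \<otimes> (mpow B q \<otimes> mword A B is)) $ i $ j"
    if "0 \<le> X" for X
    using mult_left_mono[OF le, of "X $ i $ k"] mmult_ge[of X i k "mpow B q \<otimes> mword A B is" j] that
    by (force simp: matrix_nonneg_iff)
  have "(A \<oplus> B) $ i $ k = A $ i $ k \<or> (A \<oplus> B) $ i $ k = B $ i $ k"
    by (simp add: madd_def max_def)
  then show ?case
  proof
    assume "(A \<oplus> B) $ i $ k = A $ i $ k"
    moreover have "A \<otimes> (mpow B q \<otimes> mword A B is) = mpow B 0 \<otimes> mword A B (q # is)"
      using assms nn by (simp add: mmult_mat_1_left mmult_assoc mmult_nonneg)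
    ultimately show ?thesis using step[OF assms(1)] k qi
      by (intro exI[of _ 0] exI[of _ "q # is"]) auto
  next
    assume "(A \<oplus> B) $ i $ k = B $ i $ k"
    moreover have "B \<otimes> (mpow B q \<otimes> mword A B is) = mpow B (Suc q) \<otimes> mword A B is"
      using assms nn by (simp add: mmult_assoc)
    ultimately show ?thesis using step[OF assms(2)] k qi
      by (intro exI[of _ "Suc q"] exI[of _ "is"]) auto
  qed
qed

text \<open>A cyclic shift moves the leading power of \<open>B\<close> to the end, where it merges
  with the last exponent. What remains is a word of the shape occurring in \<theta>.\<close>

lemma mtr_mpow_mult_mword:
  assumes "0 \<le> A" "0 \<le> B"
  shows "mtr (mpow B q \<otimes> mword A B (is @ [p])) = mtr (mword A B (is @ [p + q]))"
proof -
  have "mtr (mpow B q \<otimes> mword A B (is @ [p])) = mtr (mword A B (is @ [p]) \<otimes> mpow B q)"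
    by (rule mtr_mmult_commute)
  also have "mword A B (is @ [p]) \<otimes> mpow B q = mword A B (is @ [p + q])"
    using assms
    by (simp add: mword_append mpow_add mmult_assoc mmult_nonneg mpow_nonneg mword_nonneg
        mmult_mat_1_right)
  finally show ?thesis .
qed

lemma mTr_madd_le_1:
  fixes A B :: "real^'n^'n"
  assumes "0 \<le> A" "0 \<le> B" "mTr B \<le> 1"
    and words: "\<And>is. is \<noteq> [] \<Longrightarrow> length is + sum_list is \<le> CARD('n) \<Longrightarrow> mtr (mword A B is) \<le> 1"
  shows "mTr (A \<oplus> B) \<le> 1"
proof -
  have "mpow (A \<oplus> B) m $ i $ i \<le> 1" if m: "m \<in> {1..CARD('n)}" for m i
  proof -
    obtain q "is" where qi: "q + length is + sum_list is = m"
      and le: "mpow (A \<oplus> B) m $ i $ i \<le> (mpow B q \<otimes> mword A B is) $ i $ i"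
      using mpow_madd_le_mword[OF assms(1,2)] by blast
    show ?thesis
    proof (cases "is" rule: rev_cases)
      case Nil
      then show ?thesis
        using le qi mpow_le_1_if_mTr_le_1[OF assms(3) m, of i]
        by (simp add: mmult_mat_1_right mpow_nonneg assms)
    next
      case (snoc js p)
      \<comment> \<open>The shift keeps the number of letters at \<open>m\<close>, which is at most
        \<open>CARD('n)\<close>, so the assumption on words applies.\<close>
      have "mtr (mword A B (js @ [p + q])) \<le> 1"
        using qi m snoc by (intro words) auto
      then show ?thesis
        using le mtr_ge[of "mpow B q \<otimes> mword A B is" i]
        unfolding snoc mtr_mpow_mult_mword[OF assms(1,2)] by linarith
    qed
  qed
  then show ?thesis
    unfolding mTr_def by (subst Max_le_iff) (auto simp: mtr_le_iff)
qed

section \<open>Walks, cycle removal and the Kleene star\<close>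

lemma walk_weight_le_mpow:
  assumes "0 \<le> X" "a \<le> b"
  shows "(\<Prod>t\<in>{a..<b}. X $ p t $ p (Suc t)) \<le> mpow X (b - a) $ p a $ p b"
  using assms(2)
proof (induction b rule: dec_induct)
  case base
  then show ?case by (simp add: mat_def)
next
  case (step b)
  have "(\<Prod>t\<in>{a..<Suc b}. X $ p t $ p (Suc t)) = (\<Prod>t\<in>{a..<b}. X $ p t $ p (Suc t)) * X $ p b $ p (Suc b)"
    using step.hyps by (simp add: prod.atLeastLessThan_Suc)
  also have "\<dots> \<le> mpow X (b - a) $ p a $ p b * X $ p b $ p (Suc b)"
    using step.IH assms(1) by (intro mult_right_mono) (auto simp: matrix_nonneg_iff)
  also have "\<dots> \<le> (mpow X (b - a) \<otimes> X) $ p a $ p (Suc b)"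
    by (rule mmult_ge)
  \<comment> \<open>The walk grows at its right end, whereas \<open>mpow\<close> unfolds on the
    left; \<open>mpow_add\<close> bridges the two.\<close>
  also have "mpow X (b - a) \<otimes> X = mpow X (Suc b - a)"
    using mpow_add[OF assms(1), of "b - a" 1] step.hyps assms(1)
    by (simp add: mmult_mat_1_right Suc_diff_le)
  finally show ?case .
qed

text \<open>The factor \<open>mat 1 $ p m $ j\<close> expresses that the walk \<open>p\<close> ends in \<open>j\<close> or has weight \<open>0\<close>.\<close>

lemma mpow_eq_walk_weight:
  "\<exists>p. p 0 = i \<and> mpow X m $ i $ j = (\<Prod>t<m. X $ p t $ p (Suc t)) * mat 1 $ p m $ j"
proof (induction m arbitrary: i)
  case 0
  then show ?case by (intro exI[of _ "\<lambda>_. i"]) simp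
next
  case (Suc m)
  obtain k where k: "mpow X (Suc m) $ i $ j = X $ i $ k * mpow X m $ k $ j"
    using mmult_attained[of X "mpow X m" i j] by auto
  obtain p where "p 0 = k" "mpow X m $ k $ j = (\<Prod>t<m. X $ p t $ p (Suc t)) * mat 1 $ p m $ j"
    using Suc.IH by blast
  then show ?case
    using k by (intro exI[of _ "case_nat i p"]) (simp add: prod.lessThan_Suc_shift del: mpow.simps prod.lessThan_Suc)
qed

lemma mstar_ge:
  fixes X :: "real^'n^'n"
  assumes "k < CARD('n)"
  shows "mpow X k $ i $ j \<le> mstar X $ i $ j"
  unfolding mstar_def using assms by auto

lemma mstar_attained:
  fixes X :: "real^'n^'n"
  shows "\<exists>k<CARD('n). mstar X $ i $ j = mpow X k $ i $ j"
proof -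
  have "mstar X $ i $ j \<in> (\<lambda>k. mpow X k $ i $ j) ` {0..CARD('n) - 1}"
    unfolding mstar_def by (simp only: vec_lambda_beta) (rule Max_in; simp)
  then obtain k where "k \<le> CARD('n) - 1" "mstar X $ i $ j = mpow X k $ i $ j" by auto
  moreover have "0 < CARD('n)" by simp
  ultimately show ?thesis by (metis Suc_pred' less_Suc_eq_le)
qed

text \<open>The star stops at the power n - 1. A walk with n steps must repeat a vertex; cutting out
  the cycle between two visits, whose weight is at most 1, does not lower the weight and leaves
  fewer than n steps.\<close>

lemma mpow_card_le_mstar:
  fixes X :: "real^'n^'n"
  assumes "0 \<le> X" "mTr X \<le> 1"
  shows "mpow X CARD('n) $ i $ j \<le> mstar X $ i $ j"
proof -
  define n where "n = CARD('n)"
  define w where "w = (\<lambda>p t. X $ p t $ p (Suc t))"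
  have X: "0 \<le> X $ i $ j" for i j using assms(1) by (simp add: matrix_nonneg_iff)
  have pow: "0 \<le> mpow X k $ i $ j" for k i j
    using mpow_nonneg[OF assms(1)] by (simp add: matrix_nonneg_iff)
  obtain p where p: "p 0 = i" "mpow X n $ i $ j = prod (w p) {..<n} * mat 1 $ p n $ j"
    using mpow_eq_walk_weight unfolding w_def by blast
  \<comment> \<open>A walk with n steps has n + 1 positions but only n vertices to visit.\<close>
  have "\<not> inj_on p {0..n}"
    using card_inj_on_le[of p "{0..n}" UNIV] by (auto simp: n_def)
  then obtain a b where ab: "a < b" "b \<le> n" "p a = p b"
    unfolding inj_on_def by (metis atLeastAtMost_iff linorder_neqE_nat)
  have prod_nonneg: "0 \<le> prod (w p) S" for S
    by (intro prod_nonneg) (simp add: w_def X)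
  have le: "prod (w p) {c..<d} \<le> mpow X (d - c) $ p c $ p d" if "c \<le> d" for c d
    using walk_weight_le_mpow[OF assms(1) that] unfolding w_def .
  have "mpow X (b - a) $ p a $ p b \<le> 1"
    using ab assms(2) mpow_le_1_if_mTr_le_1[of X "b - a" "p b"] by (simp add: n_def Suc_le_eq)
  then have cycle: "prod (w p) {a..<b} \<le> 1"
    using le[of a b] ab by linarith
  have "prod (w p) {..<n} = prod (w p) {0..<a} * prod (w p) {a..<b} * prod (w p) {b..<n}"
    using ab by (simp add: prod.atLeastLessThan_concat lessThan_atLeast0)
  also have "\<dots> \<le> prod (w p) {0..<a} * 1 * prod (w p) {b..<n}"
    using cycle by (intro mult_right_mono mult_left_mono prod_nonneg)
  also have "\<dots> \<le> mpow X a $ i $ p a * mpow X (n - b) $ p a $ p n"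
    using le[of 0 a] le[of b n] ab p(1) prod_nonneg pow by (auto intro!: mult_mono)
  also have "\<dots> \<le> mpow X (a + (n - b)) $ i $ p n"
    unfolding mpow_add[OF assms(1)] by (rule mmult_ge)
  also have "\<dots> \<le> mstar X $ i $ p n"
    using ab by (intro mstar_ge) (simp add: n_def)
  finally have "prod (w p) {..<n} \<le> mstar X $ i $ p n" .
  \<comment> \<open>Covers walks not ending in \<open>j\<close>: the factor from
    \<open>mat 1\<close> is then 0, and nonnegativity of the star suffices.\<close>
  moreover have "0 \<le> mstar X $ i $ j"
    using mstar_attained[of X i j] pow by auto
  ultimately have "mpow X n $ i $ j \<le> mstar X $ i $ j"
    using p(2) by (auto simp: mat_def)
  then show ?thesis unfolding n_def .
qed

text \<open>Multiplying by \<open>X\<close> shifts each power by one, so only the power n leaves the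
  range of the star.\<close>

lemma mult_mstar_le_mstar:
  fixes X :: "real^'n^'n"
  assumes "0 \<le> X" "mTr X \<le> 1"
  shows "X $ i $ k * mstar X $ k $ j \<le> mstar X $ i $ j"
proof -
  obtain m where m: "m < CARD('n)" "mstar X $ k $ j = mpow X m $ k $ j"
    using mstar_attained by blast
  have "X $ i $ k * mpow X m $ k $ j \<le> mpow X (Suc m) $ i $ j"
    using mmult_ge[of X i k "mpow X m" j] by simp
  also have "\<dots> \<le> mstar X $ i $ j"
  proof (cases "Suc m = CARD('n)")
    case True
    then show ?thesis using mpow_card_le_mstar[OF assms, of i j] by simp
  next
    case False
    then show ?thesis using m(1) mstar_ge[of "Suc m" X i j] by simp
  qed
  finally show ?thesis using m(2) by simp
qed

section \<open>Subeigenvectors and the conjugate vector\<close>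

lemma mvmult_ge: "X $ i $ j * x $ j \<le> (X \<otimes>v x) $ i"
  unfolding mvmult_def by (simp add: MAX_UNIV_ge[where f = "\<lambda>j. X $ i $ j * x $ j"])

lemma mvmult_component_le_iff: "(X \<otimes>v x) $ i \<le> c \<longleftrightarrow> (\<forall>j. X $ i $ j * x $ j \<le> c)"
  unfolding mvmult_def by (simp add: MAX_UNIV_le_iff)

lemma mvmult_le_iff: "X \<otimes>v x \<le> y \<longleftrightarrow> (\<forall>i j. X $ i $ j * x $ j \<le> y $ i)"
  by (simp add: less_eq_vec_def mvmult_component_le_iff)

lemma mvmult_mstar_le:
  fixes X :: "real^'n^'n"
  assumes "0 \<le> X" "mTr X \<le> 1" "0 \<le> u"
  shows "X \<otimes>v (mstar X \<otimes>v u) \<le> mstar X \<otimes>v u"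
  unfolding mvmult_le_iff
proof (intro allI)
  fix i k
  obtain j where j: "(mstar X \<otimes>v u) $ k = mstar X $ k $ j * u $ j"
    using MAX_UNIV_attained[of "\<lambda>j. mstar X $ k $ j * u $ j"] by (auto simp: mvmult_def)
  have "X $ i $ k * (mstar X \<otimes>v u) $ k = (X $ i $ k * mstar X $ k $ j) * u $ j"
    using j by simp
  also have "\<dots> \<le> mstar X $ i $ j * u $ j"
    using assms by (intro mult_right_mono mult_mstar_le_mstar) (auto simp: less_eq_vec_def)
  also have "\<dots> \<le> (mstar X \<otimes>v u) $ i" by (rule mvmult_ge)
  finally show "X $ i $ k * (mstar X \<otimes>v u) $ k \<le> (mstar X \<otimes>v u) $ i" .
qed

text \<open>The power 0 puts ones on the diagonal of the star.\<close>

lemma mstar_mvmult_ge: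
  fixes X :: "real^'n^'n"
  assumes "0 \<le> u"
  shows "u \<le> mstar X \<otimes>v u"
  unfolding less_eq_vec_def
proof
  fix i
  have "1 \<le> mstar X $ i $ i"
    using mstar_ge[of 0 X i i] by (simp add: mat_def)
  then have "u $ i \<le> mstar X $ i $ i * u $ i"
    using assms mult_right_mono[of 1 "mstar X $ i $ i" "u $ i"] by (simp add: less_eq_vec_def)
  then show "u $ i \<le> (mstar X \<otimes>v u) $ i"
    using mvmult_ge[of "mstar X" i i u] by linarith
qed

lemma mmult_subeigen:
  assumes "0 \<le> X" "0 \<le> d"
    and "X \<otimes>v x \<le> c *\<^sub>R x" "Y \<otimes>v x \<le> d *\<^sub>R x"
  shows "(X \<otimes> Y) \<otimes>v x \<le> (c * d) *\<^sub>R x"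
  unfolding mvmult_le_iff
proof (intro allI)
  fix i j
  obtain k where "(X \<otimes> Y) $ i $ j = X $ i $ k * Y $ k $ j"
    using mmult_attained by blast
  then have "(X \<otimes> Y) $ i $ j * x $ j = X $ i $ k * (Y $ k $ j * x $ j)" by simp
  also have "\<dots> \<le> X $ i $ k * (d * x $ k)"
    using assms(1,4) by (intro mult_left_mono) (auto simp: mvmult_le_iff matrix_nonneg_iff)
  also have "\<dots> = d * (X $ i $ k * x $ k)" by simp
  also have "\<dots> \<le> d * (c * x $ i)"
    using assms(2,3) by (intro mult_left_mono) (auto simp: mvmult_le_iff)
  finally show "(X \<otimes> Y) $ i $ j * x $ j \<le> ((c * d) *\<^sub>R x) $ i" by (simp add: ac_simps)
qed

lemma mat_1_subeigen: "0 \<le> x \<Longrightarrow> mat 1 \<otimes>v x \<le> x"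
  unfolding mvmult_le_iff by (auto simp: mat_def less_eq_vec_def)

lemma mpow_subeigen:
  assumes "0 \<le> X" "0 \<le> x" "X \<otimes>v x \<le> x"
  shows "mpow X k \<otimes>v x \<le> x"
proof (induction k)
  case 0
  then show ?case using assms(2) by (simp add: mat_1_subeigen)
next
  case (Suc k)
  then show ?case using mmult_subeigen[of X 1 x 1 "mpow X k"] assms by simp
qed

text \<open>Every power of \<open>X\<close> maps \<open>x\<close> below itself, and the power 0
  returns \<open>x\<close>. Thus a solution can serve as its own parameter vector in (iii).\<close>

lemma mstar_mvmult_eq:
  fixes X :: "real^'n^'n"
  assumes "0 \<le> X" "0 \<le> x" "X \<otimes>v x \<le> x"
  shows "mstar X \<otimes>v x = x"
proof (rule antisym)
  have "mstar X $ i $ j * x $ j \<le> x $ i" for i j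
    using mstar_attained[of X i j] mpow_subeigen[OF assms] by (auto simp: mvmult_le_iff)
  then show "mstar X \<otimes>v x \<le> x" by (simp add: mvmult_le_iff)
  show "x \<le> mstar X \<otimes>v x" by (rule mstar_mvmult_ge[OF assms(2)])
qed

text \<open>Each letter \<open>A\<close> costs a factor \<open>c\<close> and the powers of
  \<open>B\<close> cost nothing.\<close>

lemma mword_subeigen:
  assumes "0 \<le> A" "0 \<le> B" "0 \<le> x" "0 \<le> c"
    and "A \<otimes>v x \<le> c *\<^sub>R x" "B \<otimes>v x \<le> x"
  shows "mword A B is \<otimes>v x \<le> c ^ length is *\<^sub>R x"
proof (induction "is")
  case Nil
  then show ?case using assms(3) by (simp add: mat_1_subeigen)
next
  case (Cons p "is")
  have "(A \<otimes> mpow B p) \<otimes>v x \<le> c *\<^sub>R x"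
    using mmult_subeigen[of A 1 x c "mpow B p"] mpow_subeigen[of B x p] assms by simp
  then show ?case
    using mmult_subeigen[of "A \<otimes> mpow B p" "c ^ length is" x c "mword A B is"] Cons assms
    by (simp add: mmult_nonneg mpow_nonneg)
qed

lemma regular_iff: "regular x \<longleftrightarrow> (\<forall>i. 0 < x $ i)"
  by (auto simp: regular_def less_eq_vec_def less_le)

lemma regular_nonneg: "regular x \<Longrightarrow> 0 \<le> x"
  by (simp add: regular_def)

lemma mtr_le_if_subeigen:
  assumes "regular x" "X \<otimes>v x \<le> c *\<^sub>R x"
  shows "mtr X \<le> c"
  unfolding mtr_le_iff
proof
  fix i
  have "X $ i $ i * x $ i \<le> c * x $ i" "0 < x $ i"
    using assms by (simp_all add: mvmult_le_iff regular_iff)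
  then show "X $ i $ i \<le> c" by simp
qed

text \<open>Multiplying row \<open>i\<close> by the positive entry \<open>x $ i\<close> turns a
  bound on the objective into a subeigenvector inequality.\<close>

lemma mconj_mvmult_le_iff:
  assumes "regular x"
  shows "mconj x \<otimes>r (X \<otimes>v x) \<le> c \<longleftrightarrow> X \<otimes>v x \<le> c *\<^sub>R x"
proof -
  have pos: "0 < x $ i" for i using assms by (simp add: regular_iff)
  have "mconj x $ i * (X \<otimes>v x) $ i \<le> c \<longleftrightarrow> (X \<otimes>v x) $ i \<le> c * x $ i" for i
    using pos[of i] by (simp add: mconj_def field_simps)
  then show ?thesis
    unfolding rcmult_def MAX_UNIV_le_iff by (simp add: less_eq_vec_def)
qed

lemma madd_mvmult_le_iff:
  assumes "0 \<le> x"
  shows "(A \<oplus> B) \<otimes>v x \<le> y \<longleftrightarrow> A \<otimes>v x \<le> y \<and> B \<otimes>v x \<le> y"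
proof -
  have "max a b * x $ j \<le> c \<longleftrightarrow> a * x $ j \<le> c \<and> b * x $ j \<le> c" for a b c j
    using assms by (simp add: max_mult_distrib_right less_eq_vec_def)
  then show ?thesis unfolding mvmult_le_iff madd_def by auto
qed

lemma scaleR_mvmult_le_iff:
  assumes "0 < c"
  shows "(inverse c *\<^sub>R A) \<otimes>v x \<le> x \<longleftrightarrow> A \<otimes>v x \<le> c *\<^sub>R x"
  unfolding mvmult_le_iff using assms by (simp add: field_simps)

section \<open>The maximum over exponent lists defining \<theta>\<close>

lemma finite_lists_length_sum_list_le:
  "finite {is :: nat list. length is = k \<and> sum_list is \<le> m}"
proof (rule finite_subset)
  show "{is :: nat list. length is = k \<and> sum_list is \<le> m} \<subseteq> {is. set is \<subseteq> {..m} \<and> length is = k}"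
    using member_le_sum_list by (fastforce intro: order_trans)
  show "finite {is. set is \<subseteq> {..m} \<and> length is = k}"
    by (rule finite_lists_length_eq) simp
qed

text \<open>For \<open>k\<close> between 1 and \<open>n\<close> the truncated difference
  \<open>n - k\<close> is exact, so the two nested ranges merge into one bound on the total number
  of letters.\<close>

lemma MAX_words_le_iff:
  fixes f :: "nat \<Rightarrow> nat list \<Rightarrow> real"
  assumes "0 < n"
  shows "(MAX k\<in>{1..n}. MAX is\<in>{is :: nat list. length is = k \<and> sum_list is \<le> n - k}. f k is) \<le> c
    \<longleftrightarrow> (\<forall>is. is \<noteq> [] \<and> length is + sum_list is \<le> n \<longrightarrow> f (length is) is \<le> c)"
proof -
  \<comment> \<open>The all-zero list is always admissible, so no inner \<open>Max\<close> is taken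
    over an empty set.\<close>
  have ne: "{is :: nat list. length is = k \<and> sum_list is \<le> m} \<noteq> {}" for k m
    by (auto intro!: exI[of _ "replicate k 0"] simp: sum_list_replicate)
  have "(MAX is\<in>{is :: nat list. length is = k \<and> sum_list is \<le> n - k}. f k is) \<le> c
      \<longleftrightarrow> (\<forall>is. length is = k \<and> sum_list is \<le> n - k \<longrightarrow> f k is \<le> c)" for k
    using ne by (subst Max_le_iff) (auto simp: finite_lists_length_sum_list_le)
  then have "(MAX k\<in>{1..n}. MAX is\<in>{is :: nat list. length is = k \<and> sum_list is \<le> n - k}. f k is) \<le> c
    \<longleftrightarrow> (\<forall>k\<in>{1..n}. \<forall>is. length is = k \<and> sum_list is \<le> n - k \<longrightarrow> f k is \<le> c)"
    using assms by (subst Max_le_iff) auto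
  also have "\<dots> \<longleftrightarrow> (\<forall>is. is \<noteq> [] \<and> length is + sum_list is \<le> n \<longrightarrow> f (length is) is \<le> c)"
    by (auto simp: Suc_le_eq)
  finally show ?thesis .
qed

theorem theorem4:
  fixes A B :: "real^'n^'n" and \<theta> :: real
  assumes "0 \<le> A" and "0 \<le> B"
    and "mspectral_radius A \<noteq> 0"
    and "mTr B \<le> 1"
    and "\<theta> = (MAX k\<in>{1..CARD('n)}.
                 MAX is\<in>{is :: nat list. length is = k \<and> sum_list is \<le> CARD('n) - k}.
                   root k (mtr (mword A B is)))"
  shows
    "((\<exists>x. regular x \<and> B \<otimes>v x \<le> x \<and> mconj x \<otimes>r (A \<otimes>v x) = \<theta>) \<and>
      (\<forall>x. regular x \<and> B \<otimes>v x \<le> x \<longrightarrow> \<theta> \<le> mconj x \<otimes>r (A \<otimes>v x))) \<and>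
     (\<forall>x.
       ((regular x \<and> B \<otimes>v x \<le> x \<and> mconj x \<otimes>r (A \<otimes>v x) = \<theta>) \<longleftrightarrow>
        (regular x \<and> (inverse \<theta> *\<^sub>R A \<oplus> B) \<otimes>v x \<le> x)) \<and>
       ((regular x \<and> (inverse \<theta> *\<^sub>R A \<oplus> B) \<otimes>v x \<le> x) \<longleftrightarrow>
        (regular x \<and> (\<exists>u. 0 \<le> u \<and> u \<noteq> 0 \<and> x = mstar (inverse \<theta> *\<^sub>R A \<oplus> B) \<otimes>v u))))"
proof -
  define n where "n = CARD('n)"
  have n: "0 < n" by (simp add: n_def)
  let ?C = "inverse \<theta> *\<^sub>R A \<oplus> B"
  have theta_le: "\<theta> \<le> c \<longleftrightarrow>
      (\<forall>is. is \<noteq> [] \<and> length is + sum_list is \<le> n \<longrightarrow> root (length is) (mtr (mword A B is)) \<le> c)" for c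
    unfolding assms(5) n_def by (rule MAX_words_le_iff) simp
  have word_nonneg: "0 \<le> mtr (mword A B is)" for "is"
    using assms(1,2) by (simp add: mtr_nonneg mword_nonneg)
  have root_le: "root (length is) (mtr (mword A B is)) \<le> \<theta>"
    if "is \<noteq> []" "length is + sum_list is \<le> n" for "is"
    using theta_le[of \<theta>] that by simp
  have "\<exists>k\<in>{1..n}. mspectral_radius A = root k (mtr (mpow A k))"
  proof -
    have "mspectral_radius A \<in> (\<lambda>k. root k (mtr (mpow A k))) ` {1..n}"
      unfolding mspectral_radius_def n_def by (rule Max_in) auto
    then show ?thesis by auto
  qed
  then obtain k where k: "k \<in> {1..n}" "root k (mtr (mpow A k)) \<noteq> 0"
    using assms(3) by auto
  have "root k (mtr (mpow A k)) \<le> \<theta>"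
    using root_le[of "replicate k 0"] k(1) assms(1) by (simp add: mword_replicate_0 sum_list_replicate)
  moreover have "0 \<le> root k (mtr (mpow A k))"
    using assms(1) by (simp add: mtr_nonneg mpow_nonneg real_root_ge_zero)
  ultimately have pos: "0 < \<theta>" using k(2) by linarith
  have C_nonneg: "0 \<le> ?C"
    using assms(1) pos by (intro madd_nonneg) (simp add: matrix_nonneg_iff)
  have C: "mTr ?C \<le> 1"
  proof (rule mTr_madd_le_1)
    show "0 \<le> inverse \<theta> *\<^sub>R A" using assms(1) pos by (simp add: matrix_nonneg_iff)
    \<comment> \<open>By the definition of \<theta>, a word with k letters \<open>A\<close> has
      trace at most the k-th power of \<theta>; scaling \<open>A\<close> by the inverse of \<theta>
      divides out exactly this power.\<close>
    show "mtr (mword (inverse \<theta> *\<^sub>R A) B is) \<le> 1"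
      if "is \<noteq> []" "length is + sum_list is \<le> CARD('n)" for "is"
    proof -
      have "mtr (mword A B is) = root (length is) (mtr (mword A B is)) ^ length is"
        using that(1) word_nonneg by simp
      also have "\<dots> \<le> \<theta> ^ length is"
        using root_le[of "is"] that word_nonneg[of "is"]
        by (intro power_mono) (auto simp: n_def real_root_ge_zero)
      finally have "mtr (mword A B is) \<le> \<theta> ^ length is" .
      then have "mword A B is $ i $ i \<le> \<theta> ^ length is" for i
        by (simp add: mtr_le_iff)
      then show ?thesis
        using pos by (simp add: mword_scaleR mtr_le_iff field_simps)
    qed
  qed (use assms in auto)
  have lower: "\<theta> \<le> mconj x \<otimes>r (A \<otimes>v x)" if x: "regular x" "B \<otimes>v x \<le> x" for x
  proof -
    define c where "c = mconj x \<otimes>r (A \<otimes>v x)"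
    have Ax: "A \<otimes>v x \<le> c *\<^sub>R x"
      using mconj_mvmult_le_iff[OF x(1), of A c] by (simp add: c_def)
    \<comment> \<open>The trace of \<open>A\<close> shows that the objective value \<open>c\<close>
      is nonnegative, as needed for powers and roots of \<open>c\<close>.\<close>
    have "0 \<le> mtr A" using assms(1) by (rule mtr_nonneg)
    also have "\<dots> \<le> c" using mtr_le_if_subeigen[OF x(1) Ax] .
    finally have c: "0 \<le> c" .
    have "root (length is) (mtr (mword A B is)) \<le> c" if "is \<noteq> []" for "is"
    proof -
      have "mtr (mword A B is) \<le> c ^ length is"
        using mword_subeigen[OF assms(1,2) regular_nonneg[OF x(1)] c Ax x(2)] x(1)
        by (intro mtr_le_if_subeigen)
      then have "root (length is) (mtr (mword A B is)) \<le> root (length is) (c ^ length is)"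
        using that by (intro real_root_le_mono) auto
      then show ?thesis using that c by (simp add: real_root_power_cancel)
    qed
    then show ?thesis unfolding theta_le c_def by simp
  qed
  \<comment> \<open>The inequality in (ii) only bounds the objective by \<theta> from above;
    \<open>lower\<close> upgrades this to equality.\<close>
  have i_iff_ii: "regular x \<and> B \<otimes>v x \<le> x \<and> mconj x \<otimes>r (A \<otimes>v x) = \<theta> \<longleftrightarrow> regular x \<and> ?C \<otimes>v x \<le> x" for x
    using lower[of x] mconj_mvmult_le_iff[of x A \<theta>]
      madd_mvmult_le_iff[of x "inverse \<theta> *\<^sub>R A" B x] scaleR_mvmult_le_iff[OF pos, of A x]
      regular_nonneg[of x]
    by (auto intro: antisym)
  have ii_iff_iii: "regular x \<and> ?C \<otimes>v x \<le> x \<longleftrightarrow>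
      regular x \<and> (\<exists>u. 0 \<le> u \<and> u \<noteq> 0 \<and> x = mstar ?C \<otimes>v u)" for x
  proof -
    have "\<exists>u. 0 \<le> u \<and> u \<noteq> 0 \<and> x = mstar ?C \<otimes>v u" if "regular x" "?C \<otimes>v x \<le> x"
      using mstar_mvmult_eq[OF C_nonneg _ that(2)] that(1)
      by (intro exI[of _ x]) (auto simp: regular_def)
    then show ?thesis using mvmult_mstar_le[OF C_nonneg C] by auto
  qed
  \<comment> \<open>The star applied to the vector of ones dominates that vector, hence is regular,
    and it solves (ii); so \<theta> is attained.\<close>
  define y where "y = mstar ?C \<otimes>v 1"
  have one: "0 \<le> (1 :: real^'n)" by (simp add: less_eq_vec_def)
  have "1 \<le> y" unfolding y_def by (rule mstar_mvmult_ge[OF one])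
  then have "regular y"
    unfolding regular_iff less_eq_vec_def by (auto intro: less_le_trans[OF zero_less_one])
  then have "regular y \<and> B \<otimes>v y \<le> y \<and> mconj y \<otimes>r (A \<otimes>v y) = \<theta>"
    unfolding i_iff_ii using mvmult_mstar_le[OF C_nonneg C one] by (simp add: y_def)
  then show ?thesis using lower i_iff_ii ii_iff_iii by blast
qed

end
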